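(* Let $K\in\mathcal S^n_o$ and $\varphi\in\Phi$. Then: (1) $\displaystyle\min_{\{E\in\mathcal E^n:\,O_\varphi(K,E)\le1\}}V(E)=\min_{\{E\in\mathcal E^n:\,O_\varphi(K,E)=1\}}V(E)$. (2) $\{E\in\mathcal E^n: O_\varphi(K,E)=1\}=\{E\in\mathcal E^n:\bar{\tilde V}_\varphi(K,E)=1\}$. (3) $\displaystyle\min_{\{E\in\mathcal E^n:\,\bar{\tilde V}_\varphi(K,E)=1\}}V(E)=\min_{\{E\in\mathcal E^n:\,\bar{\tilde V}_\varphi(K,E)\le1\}}V(E)$. Consequently, the following two problems have identical solutions: Problem $\mathrm P_3$: among all $E\in\mathcal E^n$ with $O_\varphi(K,E)\le1$, maximize $\left(\frac{\omega_n}{V(E)}\right)^{1/n}$; Problem $\tilde S_\varphi$: among all $E\in\mathcal E^n$ with $\bar{\tilde V}_\varphi(K,E)\le1$, maximize $\left(\frac{\omega_n}{V(E)}\right)^{1/n}$ (equivalently, minimize $V(E)$).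
   Context: Work in $\mathbb R^n$; $V$ is volume, $B$ the Euclidean unit ball, $\omega_n=V(B)$, $S$ spherical Lebesgue measure on the unit sphere $S^{n-1}$. $\Phi$ is the class of convex, strictly increasing functions $\varphi:[0,\infty)\to[0,\infty)$ with $\varphi(0)=0$. For a compact set $K$ that is star-shaped about the origin, the radial function is $\rho_K(x)=\sup\{\lambda\ge0:\lambda x\in K\}$, $x\ne o$; $\mathcal S^n_o$ is the class of star bodies about the origin $o$, i.e. compact sets $K$ with $\lambda x\in K$ for all $x\in K,\lambda\in[0,1]$, with $o\in\operatorname{int}K$ and $\rho_K$ continuous on $S^{n-1}$. $\mathcal E^n$ is the class of (nondegenerate, $n$-dimensional) origin-symmetric ellipsoids. $V_K^*$ is the probability measure on $S^{n-1}$ with $dV_K^*=\frac{\rho_K^n}{nV(K)}\,dS$. For $K,L\in\mathcal S^n_o$, $$\bar{\tilde V}_\varphi(K,L)=\varphi^{-1}\left(\int_{S^{n-1}}\varphi\left(\frac{\rho_K}{\rho_L}\right)dV_K^*\right),$$ $$O_\varphi(K,L)=\inf\left\{\lambda>0:\ \varphi^{-1}\left(\int_{S^{n-1}}\varphi\left(\frac{\rho_K}{\lambda\rho_L}\right)dV_K^*\right)\le1\right\}.$$ *)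

theory Defs
  imports "HOL-Analysis.Analysis"
begin

definition Phi_class :: "(real \<Rightarrow> real) set" where
  "Phi_class = {\<phi>. (\<forall>t\<ge>0. \<phi> t \<ge> 0) \<and> convex_on {0..} \<phi> \<and> strict_mono_on {0..} \<phi> \<and> \<phi> 0 = 0}"

text \<open>Members of \<^const>\<open>Phi_class\<close> are only constrained on the half-line, so the inverse is
  taken there as well; convexity makes them bijections of the half-line onto itself.\<close>

definition Phi_inv :: "(real \<Rightarrow> real) \<Rightarrow> real \<Rightarrow> real" where
  "Phi_inv \<phi> = the_inv_into {0..} \<phi>"

definition vol :: "(real^'n) set \<Rightarrow> real" where
  "vol A = measure lebesgue A"

definition radial :: "(real^'n) set \<Rightarrow> real^'n \<Rightarrow> real" where
  "radial K x = Sup {l. l \<ge> 0 \<and> l *\<^sub>R x \<in> K}"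

definition star_bodies :: "(real^'n) set set" where
  "star_bodies = {K. compact K \<and> (\<forall>x\<in>K. \<forall>l\<in>{0..1}. l *\<^sub>R x \<in> K) \<and>
     0 \<in> interior K \<and> continuous_on (sphere 0 1) (radial K)}"

definition ellipsoids :: "(real^'n) set set" where
  "ellipsoids = {E. \<exists>T :: real^'n \<Rightarrow> real^'n. linear T \<and> inj T \<and> E = T ` cball 0 1}"

text \<open>Spherical Lebesgue measure: the measure of a Borel set \<open>A\<close> of unit vectors is \<open>n\<close> times the
  volume of the cone \<open>{r u. 0 < r \<le> 1, u \<in> A}\<close>.  As \<open>sgn x = x / norm x\<close>, that cone is the
  preimage of \<open>A\<close> under \<^const>\<open>sgn\<close> in the punctured unit ball.\<close>

definition sphere_measure :: "(real^'n) measure" where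
  "sphere_measure =
     distr (scale_measure (of_nat CARD('n)) (restrict_space lborel (cball 0 1 - {0})))
       (restrict_space borel (sphere 0 1)) sgn"

definition dual_cone_measure :: "(real^'n) set \<Rightarrow> (real^'n) measure" where
  "dual_cone_measure K =
     density sphere_measure (\<lambda>u. ennreal (radial K u ^ CARD('n) / (real CARD('n) * vol K)))"

definition V_bar :: "(real \<Rightarrow> real) \<Rightarrow> (real^'n) set \<Rightarrow> (real^'n) set \<Rightarrow> real" where
  "V_bar \<phi> K L = Phi_inv \<phi> (\<integral>u. \<phi> (radial K u / radial L u) \<partial>dual_cone_measure K)"

definition O_func :: "(real \<Rightarrow> real) \<Rightarrow> (real^'n) set \<Rightarrow> (real^'n) set \<Rightarrow> real" where
  "O_func \<phi> K L =
     Inf {l. l > 0 \<and> Phi_inv \<phi> (\<integral>u. \<phi> (radial K u / (l * radial L u)) \<partial>dual_cone_measure K) \<le> 1}"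

definition attains_min :: "('a \<Rightarrow> real) \<Rightarrow> 'a set \<Rightarrow> real \<Rightarrow> bool" where
  "attains_min f A m \<longleftrightarrow> (\<exists>x\<in>A. f x = m) \<and> (\<forall>x\<in>A. m \<le> f x)"

definition maximizers :: "('a \<Rightarrow> real) \<Rightarrow> 'a set \<Rightarrow> 'a set" where
  "maximizers f A = {x. is_arg_max f (\<lambda>x. x \<in> A) x}"

definition minimizers :: "('a \<Rightarrow> real) \<Rightarrow> 'a set \<Rightarrow> 'a set" where
  "minimizers f A = {x. is_arg_min f (\<lambda>x. x \<in> A) x}"

definition volume_ratio :: "(real^'n) set \<Rightarrow> real" where
  "volume_ratio E = (vol (cball 0 1 :: (real^'n) set) / vol E) powr (1 / real CARD('n))"

end

theory Submission
  imports Defs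
begin

text \<open>Write an ellipsoid as \<open>E = {x. |A x| \<le> 1}\<close> with \<open>A\<close> invertible, so that its radial function is
  \<open>1 / |A u|\<close>, and put \<open>G A = \<integral> \<phi> (\<rho>\<^sub>K(u) |A u|)\<close>.  Convexity gives \<open>G (s A) \<le> s G A\<close> for
  \<open>0 \<le> s \<le> 1\<close>, so \<open>G\<close> is strictly increasing along rays and meets the level \<open>\<phi> 1\<close> exactly once; hence
  both functionals are at most (equal to) \<open>1\<close> at \<open>E\<close> iff \<open>G A\<close> is at most (equal to) \<open>\<phi> 1\<close>.  For existence,
  the sublevel set of \<open>G\<close> in the space of all matrices is compact, and the volume of \<open>{x. |A x| < 1}\<close> is
  lower semicontinuous there and infinite at singular matrices.\<close>

subsection \<open>Convex gauge functions\<close>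

text \<open>Convexity on the segment from 0 to \<open>t\<close>, with value 0 at the left end. All
  later scaling estimates come from this inequality.\<close>

lemma Phi_class_le:
  assumes "\<phi> \<in> Phi_class" "0 \<le> s" "s \<le> 1" "0 \<le> t"
  shows "\<phi> (s * t) \<le> s * \<phi> t"
proof -
  have "convex_on {0..} \<phi>" "\<phi> 0 = 0"
    using assms(1) by (auto simp: Phi_class_def)
  with convex_onD[of "{0..}" \<phi> s 0 t] show ?thesis
    using assms by simp
qed

lemma Phi_class_less:
  assumes "\<phi> \<in> Phi_class" "0 \<le> s" "s < t"
  shows "\<phi> s < \<phi> t"
  using assms by (auto simp: Phi_class_def strict_mono_on_def)

lemma Phi_class_mono:
  assumes "\<phi> \<in> Phi_class" "0 \<le> s" "s \<le> t"
  shows "\<phi> s \<le> \<phi> t"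
  using Phi_class_less[OF assms(1,2), of t] assms(3) by (cases "s = t") auto

lemma Phi_class_0: "\<phi> \<in> Phi_class \<Longrightarrow> \<phi> 0 = 0"
  by (simp add: Phi_class_def)

lemma Phi_class_nonneg: "\<phi> \<in> Phi_class \<Longrightarrow> 0 \<le> t \<Longrightarrow> 0 \<le> \<phi> t"
  by (simp add: Phi_class_def)

lemma Phi_class_pos: "\<phi> \<in> Phi_class \<Longrightarrow> 0 < t \<Longrightarrow> 0 < \<phi> t"
  using Phi_class_less[of \<phi> 0 t] Phi_class_0[of \<phi>] by simp

text \<open>Convexity gives continuity only on the open half-line. At the endpoint 0 the function is
  squeezed between 0 and the chord \<open>s * \<phi> 1\<close>.\<close>

lemma Phi_class_continuous:
  assumes \<phi>: "\<phi> \<in> Phi_class"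
  shows "continuous_on {0..} \<phi>"
proof -
  have "convex_on {0<..} \<phi>"
    using \<phi> by (auto simp: Phi_class_def intro: convex_on_subset)
  then have pos: "continuous_on {0<..} \<phi>"
    by (intro convex_on_continuous) auto
  have "(\<phi> \<longlongrightarrow> \<phi> t) (at t within {0..})" if "0 \<le> t" for t
  proof (cases "t = 0")
    case True
    have "((\<lambda>s. s * \<phi> 1) \<longlongrightarrow> 0 * \<phi> 1) (at 0 within {0..})"
      by (intro tendsto_intros)
    moreover have "\<forall>\<^sub>F s in at (0::real) within {0..}. s < 1"
      by (rule order_tendstoD(2)[OF tendsto_ident_at]) simp
    then have "\<forall>\<^sub>F s in at 0 within {0..}. \<phi> s \<le> s * \<phi> 1"
      unfolding eventually_at_filter
      by eventually_elim (use Phi_class_le[OF \<phi>, of _ 1] in auto)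
    moreover have "\<forall>\<^sub>F s in at 0 within {0..}. 0 \<le> \<phi> s"
      by (auto simp: eventually_at_filter Phi_class_nonneg[OF \<phi>])
    ultimately have "(\<phi> \<longlongrightarrow> 0) (at 0 within {0..})"
      by (auto intro: tendsto_sandwich[OF _ _ tendsto_const])
    with True Phi_class_0[OF \<phi>] show ?thesis by simp
  next
    case False
    with that pos have "isCont \<phi> t"
      by (simp add: continuous_on_eq_continuous_at)
    then show ?thesis
      by (simp add: isCont_def tendsto_within_subset[where S = UNIV])
  qed
  then show ?thesis
    by (simp add: continuous_on_def)
qed

section \<open>Level crossing for functions that shrink at least linearly\<close>

lemma ray_hits_level:
  fixes g :: "real \<Rightarrow> real"
  assumes cont: "continuous_on {0..} g"
    and le: "\<And>s t. 0 \<le> s \<Longrightarrow> s \<le> 1 \<Longrightarrow> 0 \<le> t \<Longrightarrow> g (s * t) \<le> s * g t"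
    and g1: "0 < g 1" and c: "0 < c"
  obtains t where "0 < t" "g t = c"
proof -
  \<comment> \<open>\<open>1 \<le> T\<close> lets \<open>1 / T\<close> serve as the shrinking
    factor, which gives linear growth \<open>g 1 * T \<le> g T\<close>; the second entry makes that
    bound reach \<open>c\<close>. The intermediate value theorem on \<open>{0..T}\<close> then
    applies.\<close>
  define T where "T = max 1 (c / g 1)"
  have T: "1 \<le> T" "c / g 1 \<le> T"
    by (auto simp: T_def)
  have "g 1 \<le> g T / T"
    using le[of "1 / T" T] T by simp
  then have "g 1 * T \<le> g T"
    using T by (simp add: field_simps)
  moreover have "c \<le> g 1 * T"
    using T g1 by (simp add: field_simps)
  ultimately have gT: "c \<le> g T" by linarith
  have g0: "g 0 \<le> 0"
    using le[of 0 0] by simp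
  then obtain t where t: "0 \<le> t" "g t = c"
    using IVT'[of g 0 c T] gT c T continuous_on_subset[OF cont, of "{0..T}"] by auto
  with g0 c have "t \<noteq> 0" by auto
  with t show ?thesis by (intro that[of t]) auto
qed

text \<open>The scaling inequality makes \<open>g r \<le> c\<close> equivalent to
  \<open>r \<le> t\<close> for a crossing point \<open>t\<close>, so the infimum is
  \<open>1 / t\<close>. The argument is \<open>1 / l\<close> because the parameter of
  \<open>O_func\<close> divides.\<close>

lemma Inf_sublevel_iff:
  fixes g :: "real \<Rightarrow> real"
  assumes cont: "continuous_on {0..} g"
    and le: "\<And>s t. 0 \<le> s \<Longrightarrow> s \<le> 1 \<Longrightarrow> 0 \<le> t \<Longrightarrow> g (s * t) \<le> s * g t"
    and g1: "0 < g 1" and c: "0 < c"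
  shows "Inf {l. 0 < l \<and> g (1 / l) \<le> c} \<le> 1 \<longleftrightarrow> g 1 \<le> c"
    and "Inf {l. 0 < l \<and> g (1 / l) \<le> c} = 1 \<longleftrightarrow> g 1 = c"
proof -
  obtain t where t: "0 < t" "g t = c"
    using ray_hits_level[OF assms] .
  have sub: "g r \<le> c \<longleftrightarrow> r \<le> t" if r: "0 < r" for r
  proof
    assume "r \<le> t"
    then have "g r \<le> r / t * c"
      using le[of "r / t" t] t r by simp
    also have "\<dots> \<le> 1 * c"
      using \<open>r \<le> t\<close> t c by (intro mult_right_mono) auto
    finally show "g r \<le> c" by simp
  next
    assume gr: "g r \<le> c"
    show "r \<le> t"
    proof (rule ccontr)
      assume "\<not> r \<le> t"
      then have "c \<le> t / r * g r"
        using le[of "t / r" r] t r by simp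
      also have "\<dots> \<le> t / r * c"
        using gr t r by (intro mult_left_mono) auto
      finally show False
        using \<open>\<not> r \<le> t\<close> t r c by (simp add: field_simps)
    qed
  qed
  \<comment> \<open>Passing to \<open>r = 1 / l\<close> reverses the order, so the admissible
    \<open>l\<close> form a closed upper ray. Positivity of \<open>l\<close> is automatic there
    since \<open>1 / t > 0\<close>.\<close>
  have "{l. 0 < l \<and> g (1 / l) \<le> c} = {1 / t..}"
  proof (intro set_eqI)
    fix l
    show "l \<in> {l. 0 < l \<and> g (1 / l) \<le> c} \<longleftrightarrow> l \<in> {1 / t..}"
    proof (cases "0 < l")
      case True
      then show ?thesis using sub[of "1 / l"] t by (simp add: field_simps)
    next
      case False
      moreover have "0 < 1 / t" using t by simp
      ultimately have "\<not> 1 / t \<le> l" by linarith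
      with False show ?thesis by simp
    qed
  qed
  then have Inf: "Inf {l. 0 < l \<and> g (1 / l) \<le> c} = 1 / t"
    by simp
  show "Inf {l. 0 < l \<and> g (1 / l) \<le> c} \<le> 1 \<longleftrightarrow> g 1 \<le> c"
    using sub[of 1] t unfolding Inf by (simp add: field_simps)
  \<comment> \<open>So far \<open>t\<close> is just some crossing point. If 1 is another, then
    \<open>1 \<le> t\<close>, and shrinking from \<open>t\<close> to 1 gives
    \<open>c \<le> c / t\<close>, hence \<open>t \<le> 1\<close>.\<close>
  have "t = 1" if "g 1 = c"
  proof -
    have "1 \<le> t" using sub[of 1] that by simp
    then have "c \<le> 1 / t * c"
      using le[of "1 / t" t] t that by simp
    then show ?thesis using \<open>1 \<le> t\<close> c t by (simp add: field_simps)
  qed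
  then show "Inf {l. 0 < l \<and> g (1 / l) \<le> c} = 1 \<longleftrightarrow> g 1 = c"
    using t unfolding Inf by auto
qed

text \<open>\<open>the_inv_into\<close> is meaningful only on the image, so a preimage of
  \<open>y\<close> has to be produced first; for positive \<open>y\<close> it is a level crossing of
  \<phi> itself. Strict monotonicity then transfers comparisons with 1.\<close>

lemma Phi_inv_iff:
  assumes \<phi>: "\<phi> \<in> Phi_class" and y: "0 \<le> y"
  shows "Phi_inv \<phi> y \<le> 1 \<longleftrightarrow> y \<le> \<phi> 1" and "Phi_inv \<phi> y = 1 \<longleftrightarrow> y = \<phi> 1"
proof -
  obtain x where x: "0 \<le> x" "\<phi> x = y"
  proof (cases "y = 0")
    case True
    with Phi_class_0[OF \<phi>] that[of 0] show ?thesis by simp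
  next
    case False
    then show ?thesis
      using ray_hits_level[of \<phi> y] that y Phi_class_continuous[OF \<phi>]
        Phi_class_le[OF \<phi>] Phi_class_pos[OF \<phi>]
      by (metis less_eq_real_def zero_less_one)
  qed
  have "inj_on \<phi> {0..}"
    using \<phi> by (auto simp: Phi_class_def intro: strict_mono_on_imp_inj_on)
  then have "Phi_inv \<phi> y = x"
    using x by (auto simp: Phi_inv_def intro: the_inv_into_f_eq)
  then show "Phi_inv \<phi> y \<le> 1 \<longleftrightarrow> y \<le> \<phi> 1" "Phi_inv \<phi> y = 1 \<longleftrightarrow> y = \<phi> 1"
    using x Phi_class_less[OF \<phi>, of x 1] Phi_class_less[OF \<phi>, of 1 x]
    by (cases x "1::real" rule: linorder_cases; auto)+
qed

subsection \<open>The cone measure\<close>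

text \<open>A small ball inside \<open>K\<close> puts \<open>e / norm u\<close> into the set under
  the supremum. Compactness bounds that set, so that \<open>Sup\<close> really dominates its
  elements.\<close>

lemma radial_pos:
  fixes K :: "(real^'n) set"
  assumes K: "K \<in> star_bodies" and u: "u \<noteq> 0"
  shows "0 < radial K u"
proof -
  have "compact K" and "0 \<in> interior K"
    using K by (auto simp: star_bodies_def)
  then obtain e B where e: "0 < e" "cball 0 e \<subseteq> K" and B: "\<And>x. x \<in> K \<Longrightarrow> norm x \<le> B"
    by (metis bounded_iff compact_imp_bounded mem_interior_cball)
  have "bdd_above {l. l \<ge> 0 \<and> l *\<^sub>R u \<in> K}"
    using B u by (intro bdd_aboveI[of _ "B / norm u"]) (fastforce simp: field_simps)
  moreover have "e / norm u \<in> {l. l \<ge> 0 \<and> l *\<^sub>R u \<in> K}"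
    using e u by auto
  ultimately have "e / norm u \<le> radial K u"
    unfolding radial_def by (rule cSup_upper[rotated])
  with e u show ?thesis
    by (meson less_le_trans zero_less_divide_iff zero_less_norm_iff)
qed

lemma vol_star_body_pos:
  fixes K :: "(real^'n) set"
  assumes K: "K \<in> star_bodies"
  shows "0 < vol K"
proof -
  have "compact K" and "0 \<in> interior K"
    using K by (auto simp: star_bodies_def)
  then obtain e where e: "0 < e" "cball 0 e \<subseteq> K"
    by (metis mem_interior_cball)
  have "0 < measure lebesgue (cball (0::real^'n) e)"
    using e content_cball_pos[of e "0::real^'n"] by simp
  also have "\<dots> \<le> measure lebesgue K"
    using e \<open>compact K\<close> by (intro measure_mono_fmeasurable) (auto simp: lmeasurable_compact)
  finally show ?thesis by (simp add: vol_def)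
qed

lemma sgn_measurable_sphere:
  "sgn \<in> measurable (scale_measure c (restrict_space lborel (cball 0 1 - {0 :: real^'n})))
     (restrict_space borel (sphere 0 1))"
proof (rule measurable_restrict_space2)
  have "sgn \<in> borel_measurable (restrict_space lborel (cball 0 1 - {0 :: real^'n}))"
    by (rule measurable_restrict_space1) simp
  then show "sgn \<in> borel_measurable (scale_measure c (restrict_space lborel (cball 0 1 - {0 :: real^'n})))"
    by (simp cong: measurable_cong_sets)
qed (auto simp: space_scale_measure space_restrict_space norm_sgn)

lemma sets_dual_cone_measure [simp, measurable_cong]:
  "sets (dual_cone_measure K) = sets (restrict_space borel (sphere 0 1))"
  by (simp add: dual_cone_measure_def sphere_measure_def)

lemma space_dual_cone_measure [simp]:
  "space (dual_cone_measure K) = sphere 0 1"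
  by (simp add: dual_cone_measure_def sphere_measure_def space_restrict_space)

lemma continuous_measurable_sphere:
  fixes f :: "real^'n \<Rightarrow> real"
  assumes "continuous_on (sphere 0 1) f"
  shows "f \<in> borel_measurable sphere_measure" "f \<in> borel_measurable (dual_cone_measure K)"
  using borel_measurable_continuous_on_restrict[OF assms]
  by (simp_all add: sphere_measure_def cong: measurable_cong_sets)

text \<open>The preimage of the whole sphere under \<open>sgn\<close> is the punctured ball, so the
  total mass is a finite multiple of the volume of that ball.\<close>

lemma finite_sphere_measure: "finite_measure (sphere_measure :: (real^'n) measure)"
proof
  have sp: "sgn -` sphere 0 1 \<inter> (cball 0 1 - {0 :: real^'n}) = cball 0 1 - {0}"
    by (auto simp: norm_sgn)
  have "emeasure lborel (cball (0 :: real^'n) 1 - {0}) \<le> emeasure lborel (cball (0 :: real^'n) 1)"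
    by (intro emeasure_mono) auto
  then have "emeasure lborel (cball (0 :: real^'n) 1 - {0}) \<noteq> \<infinity>"
    using emeasure_lborel_cball_finite[of "0 :: real^'n" 1] by (auto simp: top_unique)
  moreover have "sphere 0 1 \<in> sets (restrict_space borel (sphere (0 :: real^'n) 1))"
    by (simp add: sets_restrict_space_iff)
  then have "emeasure (sphere_measure :: (real^'n) measure) (sphere 0 1)
      = of_nat CARD('n) * emeasure lborel (cball (0 :: real^'n) 1 - {0})"
    unfolding sphere_measure_def
    by (simp add: emeasure_distr[OF sgn_measurable_sphere] space_scale_measure space_restrict_space sp
        emeasure_restrict_space)
  moreover have "space (sphere_measure :: (real^'n) measure) = sphere 0 1"
    by (simp add: sphere_measure_def space_restrict_space)
  ultimately show "emeasure (sphere_measure :: (real^'n) measure) (space sphere_measure) \<noteq> \<infinity>"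
    by (simp add: ennreal_mult_eq_top_iff)
qed

lemma continuous_density:
  fixes K :: "(real^'n) set"
  assumes K: "K \<in> star_bodies"
  shows "continuous_on (sphere 0 1) (\<lambda>u. radial K u ^ CARD('n) / (real CARD('n) * vol K))"
  using assms vol_star_body_pos[OF K] by (auto simp: star_bodies_def intro!: continuous_intros)

text \<open>The density is continuous, hence bounded on the compact sphere. Finiteness makes
  continuous functions integrable and later allows a constant dominating function.\<close>

lemma finite_dual_cone_measure:
  fixes K :: "(real^'n) set"
  assumes K: "K \<in> star_bodies"
  shows "finite_measure (dual_cone_measure K)"
proof
  let ?d = "\<lambda>u. radial K u ^ CARD('n) / (real CARD('n) * vol K)"
  interpret finite_measure "sphere_measure :: (real^'n) measure"
    by (rule finite_sphere_measure)
  have "bounded (?d ` sphere 0 1)"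
    using continuous_density[OF K] by (intro compact_imp_bounded compact_continuous_image) auto
  then obtain B where "\<And>u. norm u = 1 \<Longrightarrow> \<bar>?d u\<bar> \<le> B"
    unfolding bounded_iff by (metis imageI mem_sphere_0 real_norm_def)
  then have B: "\<And>u. norm u = 1 \<Longrightarrow> ?d u \<le> B"
    using abs_le_D1 by blast
  have sp: "space (sphere_measure :: (real^'n) measure) = sphere 0 1"
    by (simp add: sphere_measure_def space_restrict_space)
  have [measurable]: "?d \<in> borel_measurable sphere_measure"
    by (rule continuous_measurable_sphere[OF continuous_density[OF K]])
  have "emeasure (dual_cone_measure K) (space (dual_cone_measure K))
      = (\<integral>\<^sup>+ u. ennreal (?d u) \<partial>sphere_measure)"
    unfolding dual_cone_measure_def by (simp add: emeasure_density cong: nn_integral_cong)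
  also have "\<dots> \<le> (\<integral>\<^sup>+ u. ennreal B \<partial>(sphere_measure :: (real^'n) measure))"
    by (intro nn_integral_mono ennreal_leI B) (simp add: sp)
  also have "\<dots> < \<infinity>"
    using emeasure_finite[of "space (sphere_measure :: (real^'n) measure)"]
    by (simp add: ennreal_mult_eq_top_iff less_top[symmetric])
  finally show "emeasure (dual_cone_measure K) (space (dual_cone_measure K)) \<noteq> \<infinity>"
    by simp
qed

lemma integrable_dual_cone:
  fixes K :: "(real^'n) set" and f :: "real^'n \<Rightarrow> real"
  assumes K: "K \<in> star_bodies" and f: "continuous_on (sphere 0 1) f"
  shows "integrable (dual_cone_measure K) f"
proof -
  interpret finite_measure "dual_cone_measure K"
    by (rule finite_dual_cone_measure[OF K])
  have "bounded (f ` sphere 0 1)"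
    using f by (intro compact_imp_bounded compact_continuous_image) auto
  then obtain B where "\<And>u. norm u = 1 \<Longrightarrow> norm (f u) \<le> B"
    unfolding bounded_iff by (metis imageI mem_sphere_0)
  then show ?thesis
    by (intro integrable_const_bound[of _ B] AE_I2 continuous_measurable_sphere f) auto
qed

lemma integral_dual_cone_pos:
  fixes K :: "(real^'n) set" and f :: "real^'n \<Rightarrow> real"
  assumes K: "K \<in> star_bodies" and f: "continuous_on (sphere 0 1) f"
    and nonneg: "\<And>u. norm u = 1 \<Longrightarrow> 0 \<le> f u" and v: "norm v = 1" "0 < f v"
  shows "0 < (\<integral>u. f u \<partial>dual_cone_measure K)"
proof -
  let ?d = "\<lambda>u. radial K u ^ CARD('n) / (real CARD('n) * vol K)"
  \<comment> \<open>The cone over the set where \<open>f\<close> is positive, cut off by the open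
    ball and without its apex, so that it is open.\<close>
  define W where "W = {x \<in> ball 0 1 - {0}. 0 < f (sgn x)}"
  have [measurable]: "?d \<in> borel_measurable sphere_measure" "f \<in> borel_measurable sphere_measure"
    using continuous_measurable_sphere continuous_density[OF K] f by blast+
  have f': "f \<in> borel_measurable (restrict_space borel (sphere 0 1))"
    using borel_measurable_continuous_on_restrict[OF f] .
  then have Z: "{u \<in> space (restrict_space borel (sphere 0 1)). f u = 0}
      \<in> sets (restrict_space borel (sphere 0 1))"
    by measurable
  have "continuous_on (ball 0 1 - {0}) (\<lambda>x. f (sgn x))"
    by (rule continuous_on_compose2[OF f]) (auto simp: norm_sgn intro!: continuous_intros split: if_splits)
  then have "open ((ball 0 1 - {0}) \<inter> (\<lambda>x. f (sgn x)) -` {0<..})"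
    by (intro continuous_open_preimage) auto
  moreover have "(ball 0 1 - {0}) \<inter> (\<lambda>x. f (sgn x)) -` {0<..} = W"
    by (auto simp: W_def)
  ultimately have W: "open W" by simp
  \<comment> \<open>Halving moves \<open>v\<close> from the sphere into the open ball without
    changing its direction, so \<open>W\<close> is nonempty.\<close>
  have "sgn ((1/2) *\<^sub>R v) = v"
    using v by (simp add: sgn_div_norm)
  then have "(1/2) *\<^sub>R v \<in> W"
    using v by (auto simp: W_def)
  then have "\<not> negligible W"
    using open_not_negligible[OF W] by blast
  have "\<not> (AE u in dual_cone_measure K. f u = 0)"
  proof
    assume "AE u in dual_cone_measure K. f u = 0"
    then have "AE u in sphere_measure. 0 < ennreal (?d u) \<longrightarrow> f u = 0"
      unfolding dual_cone_measure_def by (subst (asm) AE_density) auto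
    moreover have "0 < ?d u" if "norm u = 1" for u
      using radial_pos[OF K, of u] vol_star_body_pos[OF K] that
      by (cases "u = 0") (auto intro!: divide_pos_pos mult_pos_pos)
    then have "AE u in (sphere_measure :: (real^'n) measure). 0 < ennreal (?d u)"
      by (intro AE_I2) (simp add: sphere_measure_def space_restrict_space)
    ultimately have "AE u in (sphere_measure :: (real^'n) measure). f u = 0"
      by eventually_elim simp
    then have "AE x in scale_measure (of_nat CARD('n)) (restrict_space lborel (cball 0 1 - {0 :: real^'n})).
        f (sgn x) = 0"
      unfolding sphere_measure_def
      by (rule iffD1[OF AE_distr_iff[OF sgn_measurable_sphere Z]])
    \<comment> \<open>The scaling factor is a nonzero natural number, so the null sets stay the
      same.\<close>
    then have "AE x in restrict_space lborel (cball 0 1 - {0 :: real^'n}). f (sgn x) = 0"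
      by (auto simp: eventually_ae_filter null_sets_def space_scale_measure)
    then have "AE x in lborel. x \<in> cball 0 1 - {0} \<longrightarrow> f (sgn x) = 0"
      by (subst (asm) AE_restrict_space_iff) auto
    then have "AE x in lborel. x \<notin> W"
      by eventually_elim (auto simp: W_def)
    then have "W \<in> null_sets lborel"
      using W by (subst (asm) AE_iff_null_sets[symmetric]) auto
    with \<open>\<not> negligible W\<close> show False
      using null_sets_completionI[of W lborel] by (simp add: negligible_iff_null_sets)
  qed
  moreover have "AE u in dual_cone_measure K. 0 \<le> f u"
    using nonneg by (intro AE_I2) simp
  ultimately show ?thesis
    using integral_nonneg_eq_0_iff_AE[OF integrable_dual_cone[OF K f]] integral_nonneg_AE[of f "dual_cone_measure K"]
    by (simp add: less_le)
qed

subsection \<open>Ellipsoids as matrices\<close>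

definition ellipsoid :: "real^'n^'n \<Rightarrow> (real^'n) set" where
  "ellipsoid A = {x. norm (A *v x) \<le> 1}"

definition open_ellipsoid :: "real^'n^'n \<Rightarrow> (real^'n) set" where
  "open_ellipsoid A = {x. norm (A *v x) < 1}"

lemma invertible_iff_ker:
  fixes A :: "real^'n^'n"
  shows "invertible A \<longleftrightarrow> (\<forall>x. A *v x = 0 \<longrightarrow> x = 0)"
  by (simp add: invertible_left_inverse matrix_left_invertible_ker)

lemma invertible_nonzero:
  fixes A :: "real^'n^'n"
  assumes "invertible A"
  shows "A \<noteq> 0"
proof
  assume "A = 0"
  then have "A *v axis i 1 = 0" for i
    by simp
  with assms show False
    by (metis axis_eq_0_iff invertible_iff_ker zero_neq_one)
qed

lemma ellipsoid_eq_image: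
  fixes A :: "real^'n^'n"
  assumes "A ** B = mat 1" "B ** A = mat 1"
  shows "ellipsoid A = (*v) B ` cball 0 1"
proof (intro set_eqI iffI)
  fix x assume "x \<in> ellipsoid A"
  then show "x \<in> (*v) B ` cball 0 1"
    using assms by (intro image_eqI[of _ _ "A *v x"]) (auto simp: ellipsoid_def matrix_vector_mul_assoc)
qed (use assms in \<open>auto simp: ellipsoid_def matrix_vector_mul_assoc\<close>)

lemma ellipsoids_eq: "ellipsoids = ellipsoid ` {A :: real^'n^'n. invertible A}"
proof (intro set_eqI iffI)
  fix E :: "(real^'n) set" assume "E \<in> ellipsoids"
  then obtain T :: "real^'n \<Rightarrow> real^'n" where T: "linear T" "inj T" "E = T ` cball 0 1"
    unfolding ellipsoids_def by blast
  then have "matrix T *v x = 0 \<longrightarrow> x = 0" for x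
    by (simp add: matrix_works linear_injective_0)
  then have "invertible (matrix T)"
    by (simp add: invertible_iff_ker)
  then obtain A where A: "A ** matrix T = mat 1" "matrix T ** A = mat 1"
    by (auto simp: invertible_def)
  then have "E = ellipsoid A"
    using T by (simp add: ellipsoid_eq_image[OF A] matrix_works)
  moreover have "invertible A"
    using A by (auto simp: invertible_def)
  ultimately show "E \<in> ellipsoid ` {A :: real^'n^'n. invertible A}"
    by blast
next
  fix E :: "(real^'n) set" assume "E \<in> ellipsoid ` {A :: real^'n^'n. invertible A}"
  then obtain A B :: "real^'n^'n" where A: "E = ellipsoid A" and B: "A ** B = mat 1" "B ** A = mat 1"
    by (auto simp: invertible_def)
  have "inj ((*v) B)"
    using B by (metis matrix_left_invertible_injective)
  then have "linear ((*v) B) \<and> inj ((*v) B) \<and> E = (*v) B ` cball 0 1"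
    using A by (simp add: ellipsoid_eq_image[OF B])
  then show "E \<in> ellipsoids"
    unfolding ellipsoids_def by blast
qed

lemma radial_ellipsoid:
  fixes A :: "real^'n^'n"
  assumes A: "invertible A" and u: "u \<noteq> 0"
  shows "radial (ellipsoid A) u = 1 / norm (A *v u)"
proof -
  have "A *v u \<noteq> 0"
    using A u by (auto simp: invertible_iff_ker)
  then have "{l. l \<ge> 0 \<and> l *\<^sub>R u \<in> ellipsoid A} = {0..1 / norm (A *v u)}"
    by (auto simp: ellipsoid_def matrix_vector_mult_scaleR field_simps)
  then show ?thesis by (simp add: radial_def)
qed

section \<open>Volumes of ellipsoids and of their degenerate limits\<close>

lemma open_open_ellipsoid [simp]: "open (open_ellipsoid A)"
  unfolding open_ellipsoid_def by (intro open_Collect_less continuous_intros)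

lemma compact_ellipsoid:
  fixes A :: "real^'n^'n"
  assumes "invertible A"
  shows "compact (ellipsoid A)"
proof -
  obtain B where B: "A ** B = mat 1" "B ** A = mat 1"
    using assms by (auto simp: invertible_def)
  show ?thesis
    unfolding ellipsoid_eq_image[OF B]
    by (intro compact_continuous_image continuous_intros compact_cball)
qed

text \<open>The two sets differ by the shell \<open>norm (A *v x) = 1\<close>, a linear image of the
  unit sphere and hence negligible. This links the extended-real volume used for semicontinuity to
  \<open>vol\<close>.\<close>

lemma emeasure_open_ellipsoid:
  fixes A :: "real^'n^'n"
  assumes "invertible A"
  shows "emeasure lborel (open_ellipsoid A) = ennreal (vol (ellipsoid A))"
proof -
  obtain B where B: "A ** B = mat 1" "B ** A = mat 1"
    using assms by (auto simp: invertible_def)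
  define Q where "Q = ellipsoid A - open_ellipsoid A"
  have [measurable]: "ellipsoid A \<in> sets borel" "open_ellipsoid A \<in> sets borel"
    using compact_ellipsoid[OF assms] by (auto intro: borel_compact)
  have "Q \<subseteq> (*v) B ` sphere 0 1"
  proof
    fix x assume "x \<in> Q"
    then show "x \<in> (*v) B ` sphere 0 1"
      using B by (intro image_eqI[of _ _ "A *v x"])
        (auto simp: Q_def ellipsoid_def open_ellipsoid_def matrix_vector_mul_assoc)
  qed
  moreover have "negligible ((*v) B ` sphere 0 1)"
    by (intro negligible_differentiable_image_negligible linear_imp_differentiable_on
        negligible_sphere) auto
  ultimately have "negligible Q"
    by (rule negligible_subset[rotated])
  moreover have "Q \<in> sets borel"
    unfolding Q_def by simp
  ultimately have "Q \<in> null_sets lborel"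
    by (auto simp: negligible_iff_null_sets null_sets_completion_iff)
  moreover have "open_ellipsoid A \<union> Q = ellipsoid A"
    by (auto simp: Q_def ellipsoid_def open_ellipsoid_def)
  ultimately have "emeasure lborel (open_ellipsoid A) = emeasure lborel (ellipsoid A)"
    using emeasure_Un_null_set[of "open_ellipsoid A" lborel Q] by simp
  also have "\<dots> = ennreal (vol (ellipsoid A))"
    using emeasure_bounded_finite[OF compact_imp_bounded[OF compact_ellipsoid[OF assms]]]
    by (simp add: vol_def emeasure_eq_ennreal_measure)
  finally show ?thesis .
qed

lemma vol_ellipsoid_pos:
  fixes A :: "real^'n^'n"
  assumes "invertible A"
  shows "0 < vol (ellipsoid A)"
proof -
  have "0 \<in> open_ellipsoid A"
    by (simp add: open_ellipsoid_def)
  then have "\<not> negligible (open_ellipsoid A)"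
    by (intro open_not_negligible) auto
  moreover have "open_ellipsoid A \<in> sets lborel"
    by simp
  ultimately have "emeasure lborel (open_ellipsoid A) \<noteq> 0"
    by (metis negligible_iff_null_sets null_setsI null_sets_completionI)
  then show ?thesis
    unfolding emeasure_open_ellipsoid[OF assms] by (metis ennreal_eq_0_iff not_le)
qed

lemma vol_ellipsoid_scaleR:
  fixes A :: "real^'n^'n"
  assumes "0 < t"
  shows "vol (ellipsoid (t *\<^sub>R A)) = (1 / t) ^ CARD('n) * vol (ellipsoid A)"
proof -
  \<comment> \<open>The summand 0 brings the dilation into the affine form of
    \<open>measure_lebesgue_affine\<close>.\<close>
  have "ellipsoid (t *\<^sub>R A) = (\<lambda>x. (1 / t) *\<^sub>R x + 0) ` ellipsoid A"
  proof (intro set_eqI iffI)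
    fix x assume "x \<in> ellipsoid (t *\<^sub>R A)"
    then show "x \<in> (\<lambda>x. (1 / t) *\<^sub>R x + 0) ` ellipsoid A"
      using assms by (intro image_eqI[of _ _ "t *\<^sub>R x"])
        (auto simp: ellipsoid_def scaleR_matrix_vector_assoc[symmetric] matrix_vector_mult_scaleR)
  qed (use assms in \<open>auto simp: ellipsoid_def scaleR_matrix_vector_assoc[symmetric] matrix_vector_mult_scaleR\<close>)
  then show ?thesis
    using assms by (simp only: vol_def measure_lebesgue_affine) simp
qed

text \<open>The set is invariant under translation by kernel vectors, so it contains infinitely many
  disjoint balls of one radius.\<close>

lemma emeasure_open_ellipsoid_singular:
  fixes A :: "real^'n^'n"
  assumes "\<not> invertible A"
  shows "emeasure lborel (open_ellipsoid A) = \<infinity>"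
proof -
  obtain w0 where w0: "A *v w0 = 0" "w0 \<noteq> 0"
    using assms by (auto simp: invertible_iff_ker)
  have "0 \<in> open_ellipsoid A"
    by (simp add: open_ellipsoid_def)
  then obtain r where r: "0 < r" "ball 0 r \<subseteq> open_ellipsoid A"
    using open_contains_ball open_open_ellipsoid by blast
  \<comment> \<open>Length \<open>2 * r\<close> is exactly what keeps open balls of radius
    \<open>r\<close> around distinct multiples of \<open>w\<close> disjoint.\<close>
  define w where "w = (2 * r / norm w0) *\<^sub>R w0"
  have w: "A *v w = 0" "norm w = 2 * r"
    using w0 r by (auto simp: w_def matrix_vector_mult_scaleR)
  define b where "b k = ball (real k *\<^sub>R w) r" for k
  have sub: "b k \<subseteq> open_ellipsoid A" for k
  proof
    fix x assume "x \<in> b k"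
    then have "x - real k *\<^sub>R w \<in> open_ellipsoid A"
      using r by (auto simp: b_def dist_norm norm_minus_commute)
    then show "x \<in> open_ellipsoid A"
      using w by (simp add: open_ellipsoid_def matrix_vector_mult_diff_distrib matrix_vector_mult_scaleR)
  qed
  have disj: "disjoint_family b"
  proof (unfold disjoint_family_on_def, intro ballI impI)
    fix j k :: nat assume "j \<noteq> k"
    then have "1 \<le> \<bar>real j - real k\<bar>" by linarith
    moreover have "dist (real j *\<^sub>R w) (real k *\<^sub>R w) = \<bar>real j - real k\<bar> * (2 * r)"
      using w by (simp add: dist_norm scaleR_diff_left[symmetric])
    ultimately have "r + r \<le> dist (real j *\<^sub>R w) (real k *\<^sub>R w)"
      using r mult_right_mono[of 1 "\<bar>real j - real k\<bar>" "2 * r"] by linarith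
    then show "b j \<inter> b k = {}"
      unfolding b_def by (rule disjoint_ballI)
  qed
  define e where "e = unit_ball_vol (real CARD('n)) * r ^ CARD('n)"
  have e: "0 < e"
    using r unfolding e_def by simp
  have "emeasure lborel (b k) = ennreal e" for k
    using r by (simp add: b_def e_def emeasure_ball)
  then have "(\<Sum>k. ennreal e) = emeasure lborel (\<Union>k. b k)"
    using suminf_emeasure[of b lborel] disj by (simp add: b_def image_subset_iff)
  also have "\<dots> \<le> emeasure lborel (open_ellipsoid A)"
    using sub by (intro emeasure_mono) auto
  finally have "(\<Sum>k::nat. ennreal e) \<le> emeasure lborel (open_ellipsoid A)" .
  moreover have "(\<Sum>k::nat. ennreal e) = \<infinity>"
  proof -
    have "\<not> summable (\<lambda>k::nat. e)"
      using e summable_const_iff[of e] by simp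
    then show ?thesis
      using summable_suminf_not_top[of "\<lambda>k::nat. e"] e
      unfolding infinity_ennreal_def by (meson less_imp_le)
  qed
  ultimately show ?thesis
    by (simp add: top_unique)
qed

section \<open>Lower semicontinuity of the volume and existence of minimizers\<close>

lemma matrix_vector_tendsto:
  fixes A :: "real^'n^'m"
  assumes "X \<longlonglongrightarrow> A"
  shows "(\<lambda>k. X k *v x) \<longlonglongrightarrow> A *v x"
  unfolding matrix_vector_mult_def
  by (intro vec_tendstoI) (auto intro!: tendsto_intros tendsto_vec_nth assms)

text \<open>By Fatou's lemma the volume is lower semicontinuous on all matrices; open ellipsoids make
  the indicator functions themselves lower semicontinuous.\<close>

lemma emeasure_open_ellipsoid_liminf:
  fixes A :: "real^'n^'n"
  assumes "X \<longlonglongrightarrow> A"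
  shows "emeasure lborel (open_ellipsoid A) \<le> liminf (\<lambda>k. emeasure lborel (open_ellipsoid (X k)))"
proof -
  have "indicator (open_ellipsoid A) x
      \<le> liminf (\<lambda>k. indicator (open_ellipsoid (X k)) x :: ennreal)" for x
  proof (cases "x \<in> open_ellipsoid A")
    case True
    then have "\<forall>\<^sub>F k in sequentially. norm (X k *v x) < 1"
      by (intro order_tendstoD(2)[OF tendsto_norm[OF matrix_vector_tendsto[OF assms]]])
         (simp add: open_ellipsoid_def)
    then have "\<forall>\<^sub>F k in sequentially. 1 \<le> (indicator (open_ellipsoid (X k)) x :: ennreal)"
      by eventually_elim (simp add: open_ellipsoid_def)
    then have "1 \<le> liminf (\<lambda>k. indicator (open_ellipsoid (X k)) x :: ennreal)"
      by (rule Liminf_bounded)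
    then show ?thesis using True by simp
  qed simp
  then have "(\<integral>\<^sup>+ x. indicator (open_ellipsoid A) x \<partial>lborel)
      \<le> (\<integral>\<^sup>+ x. liminf (\<lambda>k. indicator (open_ellipsoid (X k)) x) \<partial>lborel)"
    by (intro nn_integral_mono)
  also have "\<dots> \<le> liminf (\<lambda>k. \<integral>\<^sup>+ x. indicator (open_ellipsoid (X k)) x \<partial>lborel)"
    by (intro nn_integral_liminf borel_measurable_indicator) simp
  finally show ?thesis by simp
qed

text \<open>Direct method: a minimizing sequence has a convergent subsequence, and lower
  semicontinuity bounds the volume at the limit by the infimum. Values in the extended reals allow
  for singular members of \<open>S\<close>.\<close>

lemma emeasure_open_ellipsoid_attains_inf:
  fixes S :: "(real^'n^'n) set"
  assumes S: "compact S" "S \<noteq> {}"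
  obtains A where "A \<in> S"
    "\<And>B. B \<in> S \<Longrightarrow> emeasure lborel (open_ellipsoid A) \<le> emeasure lborel (open_ellipsoid B)"
proof -
  define f where "f A = emeasure lborel (open_ellipsoid A)" for A :: "real^'n^'n"
  obtain v where v: "\<And>n::nat. v n \<in> f ` S" "v \<longlonglongrightarrow> Inf (f ` S)"
    using Inf_as_limit[of "f ` S"] S by auto
  then have "\<forall>n. \<exists>A\<in>S. v n = f A" by blast
  then obtain X where X: "\<And>n. X n \<in> S" "\<And>n. v n = f (X n)" by metis
  obtain A r where A: "A \<in> S" and r: "strict_mono r" "(X \<circ> r) \<longlonglongrightarrow> A"
    using S(1) X(1) unfolding compact_def by metis
  have "f A \<le> liminf (\<lambda>k. f ((X \<circ> r) k))"
    unfolding f_def by (rule emeasure_open_ellipsoid_liminf[OF r(2)])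
  also have "(\<lambda>k. f ((X \<circ> r) k)) = v \<circ> r"
    by (auto simp: X)
  also have "liminf (v \<circ> r) = Inf (f ` S)"
    by (intro lim_imp_Liminf LIMSEQ_subseq_LIMSEQ[OF v(2) r(1)]) simp
  finally have "f A \<le> f B" if "B \<in> S" for B
    using that by (meson INF_lower order_trans)
  with A that show ?thesis unfolding f_def by blast
qed

subsection \<open>The dual mean as a function of the matrix\<close>

text \<open>The quotient of radial functions is replaced by a product that is defined for every
  matrix, and the outer inverse of \<phi> is left off.\<close>

definition dual_mean :: "(real \<Rightarrow> real) \<Rightarrow> (real^'n) set \<Rightarrow> real^'n^'n \<Rightarrow> real" where
  "dual_mean \<phi> K A = (\<integral>u. \<phi> (radial K u * norm (A *v u)) \<partial>dual_cone_measure K)"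

context
  fixes K :: "(real^'n) set" and \<phi> :: "real \<Rightarrow> real"
  assumes K: "K \<in> star_bodies" and \<phi>: "\<phi> \<in> Phi_class"
begin

lemma integrand_arg_nonneg:
  assumes "norm u = 1"
  shows "0 \<le> radial K u * norm (A *v u)"
proof -
  have "u \<noteq> 0" using assms by auto
  then show ?thesis using radial_pos[OF K] by (intro mult_nonneg_nonneg less_imp_le norm_ge_zero)
qed

lemma integrand_continuous:
  "continuous_on (sphere 0 1) (\<lambda>u. \<phi> (radial K u * norm (A *v u)))"
proof (rule continuous_on_compose2[OF Phi_class_continuous[OF \<phi>]])
  have "continuous_on (sphere 0 1) (radial K)"
    using K by (simp add: star_bodies_def)
  then show "continuous_on (sphere 0 1) (\<lambda>u. radial K u * norm (A *v u))"
    by (intro continuous_intros)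
  show "(\<lambda>u. radial K u * norm (A *v u)) ` sphere 0 1 \<subseteq> {0..}"
    using integrand_arg_nonneg by (intro image_subsetI) simp
qed

lemma dual_mean_nonneg: "0 \<le> dual_mean \<phi> K A"
  unfolding dual_mean_def
  by (intro integral_nonneg_AE AE_I2 Phi_class_nonneg[OF \<phi>] integrand_arg_nonneg) simp

text \<open>Some direction is not annihilated by \<open>A\<close>, and the continuous integrand is
  positive there. Singular nonzero matrices are included, as compactness of the sublevel sets
  requires.\<close>

lemma dual_mean_pos:
  assumes "A \<noteq> 0"
  shows "0 < dual_mean \<phi> K A"
proof -
  obtain w where w: "A *v w \<noteq> 0"
    using assms by (metis matrix_eq matrix_vector_mult_0)
  then have w0: "w \<noteq> 0" by auto
  have "A *v sgn w \<noteq> 0"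
    using w w0 by (simp add: sgn_div_norm matrix_vector_mult_scaleR)
  then show ?thesis
    unfolding dual_mean_def
  proof (intro integral_dual_cone_pos[OF K integrand_continuous, where v = "sgn w"])
    show "norm (sgn w) = 1"
      using w0 by (simp add: norm_sgn)
    have "sgn w \<noteq> 0"
      using w0 by (simp add: sgn_zero_iff)
    with \<open>A *v sgn w \<noteq> 0\<close> show "0 < \<phi> (radial K (sgn w) * norm (A *v sgn w))"
      using radial_pos[OF K] by (intro Phi_class_pos[OF \<phi>] mult_pos_pos) simp_all
  qed (intro Phi_class_nonneg[OF \<phi>] integrand_arg_nonneg)
qed

lemma dual_mean_scaleR_le:
  assumes "0 \<le> s" "s \<le> 1"
  shows "dual_mean \<phi> K (s *\<^sub>R A) \<le> s * dual_mean \<phi> K A"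
proof -
  have "\<phi> (radial K u * norm (s *\<^sub>R A *v u)) \<le> s * \<phi> (radial K u * norm (A *v u))"
    if "norm u = 1" for u
    using Phi_class_le[OF \<phi> assms integrand_arg_nonneg[OF that, of A]] assms
    by (simp add: scaleR_matrix_vector_assoc[symmetric] mult_ac)
  then show ?thesis
    unfolding dual_mean_def integral_mult_right_zero[symmetric]
    by (intro integral_mono integrable_mult_right integrable_dual_cone[OF K] integrand_continuous) auto
qed

text \<open>Dominated convergence along a sequence of matrices. The dominating constant is \<phi> at
  the product of a bound \<open>R\<close> for the radial function and a uniform bound
  \<open>b\<close> for the vectors \<open>X k *v u\<close>.\<close>

lemma continuous_dual_mean: "continuous_on UNIV (dual_mean \<phi> K)"
proof (clarsimp simp: continuous_on_sequentially o_def)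
  fix X and A :: "real^'n^'n" assume X: "X \<longlonglongrightarrow> A"
  interpret finite_measure "dual_cone_measure K"
    by (rule finite_dual_cone_measure[OF K])
  obtain R where R: "\<And>u. norm u = 1 \<Longrightarrow> radial K u \<le> R"
  proof -
    have "bounded (radial K ` sphere 0 1)"
      using K by (intro compact_imp_bounded compact_continuous_image) (auto simp: star_bodies_def)
    then obtain R where "\<And>u. norm u = 1 \<Longrightarrow> \<bar>radial K u\<bar> \<le> R"
      unfolding bounded_iff by (metis imageI mem_sphere_0 real_norm_def)
    then show ?thesis by (intro that[of R]) (simp add: abs_le_iff)
  qed
  obtain b where b: "\<And>k u. norm u = 1 \<Longrightarrow> norm (X k *v u) \<le> b"
  proof -
    obtain b where b: "\<And>k. norm (X k) \<le> b"
      using convergent_imp_Bseq[OF convergentI[OF X]] by (auto simp: Bseq_def)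
    \<comment> \<open>The factor comes from \<open>onorm_le_matrix_component\<close>, which bounds
      the operator norm by the number of entries times an entrywise bound.\<close>
    have "norm (X k *v u) \<le> real CARD('n) * real CARD('n) * b" if "norm u = 1" for k u
    proof -
      have "\<bar>X k $ i $ j\<bar> \<le> b" for i j
        using component_le_norm_cart[of "X k $ i" j] Finite_Cartesian_Product.norm_nth_le[of "X k" i] b[of k]
        by linarith
      then have "onorm ((*v) (X k)) \<le> real CARD('n) * real CARD('n) * b"
        by (rule onorm_le_matrix_component)
      then show ?thesis
        using onorm[OF matrix_vector_mul_bounded_linear, of "X k" u] that by simp
    qed
    then show ?thesis using that by blast
  qed
  show "(\<lambda>k. dual_mean \<phi> K (X k)) \<longlonglongrightarrow> dual_mean \<phi> K A"
    unfolding dual_mean_def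
  proof (rule integral_dominated_convergence)
    show "AE u in dual_cone_measure K. (\<lambda>k. \<phi> (radial K u * norm (X k *v u)))
        \<longlonglongrightarrow> \<phi> (radial K u * norm (A *v u))"
    proof (intro AE_I2)
      fix u assume "u \<in> space (dual_cone_measure K)"
      then have u: "norm u = 1" by simp
      have "(\<lambda>k. X k *v u) \<longlonglongrightarrow> A *v u"
        by (rule matrix_vector_tendsto[OF X])
      then have "(\<lambda>k. radial K u * norm (X k *v u)) \<longlonglongrightarrow> radial K u * norm (A *v u)"
        by (intro tendsto_intros)
      then show "(\<lambda>k. \<phi> (radial K u * norm (X k *v u))) \<longlonglongrightarrow> \<phi> (radial K u * norm (A *v u))"
        using integrand_arg_nonneg[OF u]
        by (intro continuous_on_tendsto_compose[OF Phi_class_continuous[OF \<phi>]]) auto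
    qed
    show "AE u in dual_cone_measure K. norm (\<phi> (radial K u * norm (X k *v u))) \<le> \<phi> (R * b)" for k
    proof (intro AE_I2)
      fix u assume "u \<in> space (dual_cone_measure K)"
      then have u: "norm u = 1" by simp
      have "0 \<le> radial K u" using radial_pos[OF K, of u] u by (cases "u = 0") auto
      then have "radial K u * norm (X k *v u) \<le> R * b"
        using R[OF u] b[OF u] by (intro mult_mono) auto
      then show "norm (\<phi> (radial K u * norm (X k *v u))) \<le> \<phi> (R * b)"
        using Phi_class_nonneg[OF \<phi> integrand_arg_nonneg[OF u, of "X k"]]
          Phi_class_mono[OF \<phi> integrand_arg_nonneg[OF u, of "X k"]] by simp
    qed
  qed (auto intro!: continuous_measurable_sphere integrand_continuous)
qed

section \<open>Compact sublevel sets and the minimizing matrix\<close>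

lemma compact_dual_mean_sublevel: "compact {A. dual_mean \<phi> K A \<le> c}"
proof -
  have "compact (sphere (0 :: real^'n^'n) 1)" "sphere (0 :: real^'n^'n) 1 \<noteq> {}"
    by auto
  then obtain A0 where A0: "norm A0 = 1" "\<And>A. norm A = 1 \<Longrightarrow> dual_mean \<phi> K A0 \<le> dual_mean \<phi> K A"
    using continuous_attains_inf[of "sphere 0 1" "dual_mean \<phi> K"]
      continuous_on_subset[OF continuous_dual_mean] by auto
  \<comment> \<open>The positive minimum over matrices of norm 1. Normalizing a matrix of norm above
    1 gives \<open>m \<le> c / norm A\<close>, which bounds the sublevel set; the entry 1 in the
    maximum below covers the remaining matrices.\<close>
  define m where "m = dual_mean \<phi> K A0"
  have m: "0 < m"
    using dual_mean_pos[of A0] A0(1) by (force simp: m_def)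
  have "norm A \<le> max 1 (c / m)" if "dual_mean \<phi> K A \<le> c" for A
  proof (cases "norm A \<le> 1")
    case False
    then have n: "1 / norm A \<le> 1"
      by (simp add: divide_le_eq_1)
    have "m \<le> dual_mean \<phi> K ((1 / norm A) *\<^sub>R A)"
      unfolding m_def using False by (intro A0) auto
    also have "\<dots> \<le> 1 / norm A * dual_mean \<phi> K A"
      using n by (intro dual_mean_scaleR_le) auto
    also have "\<dots> \<le> 1 / norm A * c"
      using that by (intro mult_left_mono) auto
    finally have "m \<le> 1 / norm A * c" .
    moreover have "0 < norm A"
      using False by linarith
    ultimately show ?thesis
      using m by (simp add: field_simps le_max_iff_disj)
  qed auto
  then have "bounded {A. dual_mean \<phi> K A \<le> c}"
    by (auto simp: bounded_iff)
  moreover have "closed {A. dual_mean \<phi> K A \<le> c}"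
    by (intro closed_Collect_le continuous_dual_mean continuous_on_const)
  ultimately show ?thesis
    by (simp add: compact_eq_bounded_closed)
qed

text \<open>These are the assumptions of \<open>ray_hits_level\<close> and
  \<open>Inf_sublevel_iff\<close> for the map from \<open>t\<close> to
  \<open>dual_mean \<phi> K (t *\<^sub>R A)\<close>, hence the form
  \<open>1 *\<^sub>R A\<close>.\<close>

lemma dual_mean_ray:
  assumes "A \<noteq> 0"
  shows "continuous_on {0..} (\<lambda>t. dual_mean \<phi> K (t *\<^sub>R A))"
    and "\<And>s t. 0 \<le> s \<Longrightarrow> s \<le> 1 \<Longrightarrow> dual_mean \<phi> K ((s * t) *\<^sub>R A) \<le> s * dual_mean \<phi> K (t *\<^sub>R A)"
    and "0 < dual_mean \<phi> K (1 *\<^sub>R A)"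
  using dual_mean_scaleR_le[of _ "_ *\<^sub>R A"] dual_mean_pos[OF assms]
  by (auto intro!: continuous_on_compose2[OF continuous_dual_mean] continuous_intros)

text \<open>Enlarging a matrix shrinks its ellipsoid, so the minimum over the compact sublevel set is
  attained on the boundary.  A singular matrix gives infinite volume.\<close>

lemma min_vol_matrix:
  assumes c: "0 < c"
  obtains A where "invertible A" "dual_mean \<phi> K A = c"
    "\<And>B. invertible B \<Longrightarrow> dual_mean \<phi> K B \<le> c \<Longrightarrow> vol (ellipsoid A) \<le> vol (ellipsoid B)"
proof -
  let ?S = "{A. dual_mean \<phi> K A \<le> c}" and ?e = "\<lambda>A. emeasure lborel (open_ellipsoid A)"
  have lev: "\<exists>t>0. dual_mean \<phi> K (t *\<^sub>R A) = c" if "invertible A" for A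
    using ray_hits_level[OF dual_mean_ray[OF invertible_nonzero[OF that]] c] by blast
  have inv1: "invertible (mat 1 :: real^'n^'n)"
    by (auto simp: invertible_iff_ker)
  \<comment> \<open>A multiple of the identity shows that the sublevel set is nonempty and also
    supplies a competitor of finite volume, which rules out a singular minimizer.\<close>
  then obtain s where s: "0 < s" "dual_mean \<phi> K (s *\<^sub>R mat 1) = c"
    using lev by blast
  then have "s *\<^sub>R mat 1 \<in> ?S" by simp
  then obtain A where A: "dual_mean \<phi> K A \<le> c" and min: "\<And>B. B \<in> ?S \<Longrightarrow> ?e A \<le> ?e B"
    using emeasure_open_ellipsoid_attains_inf[OF compact_dual_mean_sublevel[of c]] by blast
  have "?e A \<le> ?e (s *\<^sub>R mat 1 :: real^'n^'n)"
    using min[of "s *\<^sub>R mat 1"] s(2) by simp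
  also have "\<dots> < \<infinity>"
    using s inv1 by (simp add: emeasure_open_ellipsoid scalar_invertible)
  finally have inv: "invertible A"
    using emeasure_open_ellipsoid_singular[of A] by (metis less_irrefl)
  have least: "vol (ellipsoid A) \<le> vol (ellipsoid B)" if "invertible B" "dual_mean \<phi> K B \<le> c" for B
    using min[of B] that inv by (simp add: emeasure_open_ellipsoid vol_def)
  \<comment> \<open>The point of the ray through \<open>A\<close> at level \<open>c\<close> is
    itself a competitor. Minimality of \<open>A\<close> forces \<open>t \<le> 1\<close>, and the
    scaling inequality then gives \<open>c \<le> dual_mean \<phi> K A\<close>.\<close>
  obtain t where t: "0 < t" "dual_mean \<phi> K (t *\<^sub>R A) = c"
    using lev inv by blast
  have "1 * vol (ellipsoid A) \<le> (1 / t) ^ CARD('n) * vol (ellipsoid A)"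
    using least[of "t *\<^sub>R A"] t inv
    by (simp add: scalar_invertible vol_ellipsoid_scaleR[symmetric])
  then have "1 \<le> (1 / t) ^ CARD('n)"
    using vol_ellipsoid_pos[OF inv] by (simp only: mult_le_cancel_right_pos)
  then have "t ^ CARD('n) \<le> 1"
    using t by (simp add: power_one_over field_simps)
  then have "t \<le> 1"
    using one_less_power[of t "CARD('n)"] by (meson not_less zero_less_card_finite)
  then have "c \<le> t * dual_mean \<phi> K A"
    using dual_mean_scaleR_le[of t A] t by simp
  also have "\<dots> \<le> 1 * dual_mean \<phi> K A"
    using \<open>t \<le> 1\<close> by (intro mult_right_mono dual_mean_nonneg)
  finally show ?thesis
    using that A inv least by auto
qed

section \<open>Translating both functionals into conditions on the dual mean\<close>

lemma integral_ellipsoid: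
  assumes A: "invertible A" and l: "0 < l"
  shows "(\<integral>u. \<phi> (radial K u / (l * radial (ellipsoid A) u)) \<partial>dual_cone_measure K)
    = dual_mean \<phi> K ((1 / l) *\<^sub>R A)"
  unfolding dual_mean_def
proof (rule Bochner_Integration.integral_cong)
  fix u assume "u \<in> space (dual_cone_measure K)"
  then have "u \<noteq> 0" by auto
  \<comment> \<open>The factor \<open>1 / l\<close> moves into the norm, so varying the parameter of
    \<open>O_func\<close> means moving along the ray through \<open>A\<close>.\<close>
  then show "\<phi> (radial K u / (l * radial (ellipsoid A) u))
      = \<phi> (radial K u * norm ((1 / l) *\<^sub>R A *v u))"
    using l by (simp add: radial_ellipsoid[OF A] scaleR_matrix_vector_assoc[symmetric])
qed simp

lemma V_bar_ellipsoid_iff: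
  assumes A: "invertible A"
  shows "V_bar \<phi> K (ellipsoid A) \<le> 1 \<longleftrightarrow> dual_mean \<phi> K A \<le> \<phi> 1"
    and "V_bar \<phi> K (ellipsoid A) = 1 \<longleftrightarrow> dual_mean \<phi> K A = \<phi> 1"
  using Phi_inv_iff[OF \<phi> dual_mean_nonneg, of A] integral_ellipsoid[OF A, of 1]
  by (simp_all add: V_bar_def)

lemma O_func_ellipsoid_iff:
  assumes A: "invertible A"
  shows "O_func \<phi> K (ellipsoid A) \<le> 1 \<longleftrightarrow> dual_mean \<phi> K A \<le> \<phi> 1"
    and "O_func \<phi> K (ellipsoid A) = 1 \<longleftrightarrow> dual_mean \<phi> K A = \<phi> 1"
proof -
  have O: "O_func \<phi> K (ellipsoid A) = Inf {l. 0 < l \<and> dual_mean \<phi> K ((1 / l) *\<^sub>R A) \<le> \<phi> 1}"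
    unfolding O_func_def
    by (intro arg_cong[where f = Inf] Collect_cong conj_cong refl)
       (simp only: integral_ellipsoid[OF A] Phi_inv_iff[OF \<phi> dual_mean_nonneg])
  from Inf_sublevel_iff[OF dual_mean_ray[OF invertible_nonzero[OF A]] Phi_class_pos[OF \<phi> zero_less_one]]
  show "O_func \<phi> K (ellipsoid A) \<le> 1 \<longleftrightarrow> dual_mean \<phi> K A \<le> \<phi> 1"
    "O_func \<phi> K (ellipsoid A) = 1 \<longleftrightarrow> dual_mean \<phi> K A = \<phi> 1"
    unfolding O by simp_all
qed

lemma O_func_iff_V_bar:
  assumes "E \<in> ellipsoids"
  shows "O_func \<phi> K E \<le> 1 \<longleftrightarrow> V_bar \<phi> K E \<le> 1" and "O_func \<phi> K E = 1 \<longleftrightarrow> V_bar \<phi> K E = 1"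
  using assms by (auto simp: ellipsoids_eq O_func_ellipsoid_iff V_bar_ellipsoid_iff)

text \<open>One ellipsoid serves both sets: the minimizer over the sublevel set lies on the level
  \<open>\<phi> 1\<close>, hence in the smaller set.\<close>

lemma min_volume_attained:
  "\<exists>m. attains_min vol {E \<in> ellipsoids. V_bar \<phi> K E = 1} m \<and>
       attains_min vol {E \<in> ellipsoids. V_bar \<phi> K E \<le> 1} m"
proof -
  obtain A where A: "invertible A" "dual_mean \<phi> K A = \<phi> 1"
    "\<And>B. invertible B \<Longrightarrow> dual_mean \<phi> K B \<le> \<phi> 1 \<Longrightarrow> vol (ellipsoid A) \<le> vol (ellipsoid B)"
    using min_vol_matrix[OF Phi_class_pos[OF \<phi> zero_less_one]] by blast
  have least: "vol (ellipsoid A) \<le> vol E" if "E \<in> ellipsoids" "V_bar \<phi> K E \<le> 1" for E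
    using that A(3) by (auto simp: ellipsoids_eq V_bar_ellipsoid_iff)
  have "ellipsoid A \<in> {E \<in> ellipsoids. V_bar \<phi> K E = 1}"
    using A V_bar_ellipsoid_iff(2)[of A] by (auto simp: ellipsoids_eq)
  then have "attains_min vol {E \<in> ellipsoids. V_bar \<phi> K E = 1} (vol (ellipsoid A)) \<and>
      attains_min vol {E \<in> ellipsoids. V_bar \<phi> K E \<le> 1} (vol (ellipsoid A))"
    using least unfolding attains_min_def by fastforce
  then show ?thesis ..
qed

end

section \<open>Volume ratio against volume, and the conclusion\<close>

lemma vol_unit_ball_pos: "0 < vol (cball 0 1 :: (real^'n) set)"
  using content_cball_pos[of 1 "0::real^'n"] by (simp add: vol_def)

lemma volume_ratio_less_iff:
  fixes E F :: "(real^'n) set"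
  assumes "E \<in> ellipsoids" "F \<in> ellipsoids"
  shows "volume_ratio E < volume_ratio F \<longleftrightarrow> vol F < vol E"
proof -
  have pos: "0 < vol E" "0 < vol F"
    using assms by (auto simp: ellipsoids_eq vol_ellipsoid_pos)
  let ?w = "vol (cball 0 1 :: (real^'n) set)"
  have "strict_mono_on {0..} (\<lambda>x::real. x powr (1 / real CARD('n)))"
    by (intro strict_mono_onI powr_less_mono2) auto
  from strict_mono_on_less[OF this]
  have "volume_ratio E < volume_ratio F \<longleftrightarrow> ?w / vol E < ?w / vol F"
    unfolding volume_ratio_def using pos vol_unit_ball_pos[where 'n = 'n] by simp
  also have "\<dots> \<longleftrightarrow> vol F < vol E"
    using pos vol_unit_ball_pos[where 'n = 'n] by (simp add: field_simps)
  finally show ?thesis .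
qed

text \<open>Both notions say that no member of the set is strictly better, so the reversal of strict
  comparisons suffices.\<close>

lemma maximizers_eq_minimizers:
  "A \<subseteq> ellipsoids \<Longrightarrow> maximizers volume_ratio A = minimizers vol A"
  unfolding maximizers_def minimizers_def is_arg_max_def is_arg_min_def
  using volume_ratio_less_iff by blast

theorem lemma4p8:
  fixes K :: "(real^'n) set" and \<phi> :: "real \<Rightarrow> real"
  assumes "K \<in> star_bodies" and "\<phi> \<in> Phi_class"
  shows "(\<exists>m. attains_min vol {E \<in> ellipsoids. O_func \<phi> K E \<le> 1} m \<and>
              attains_min vol {E \<in> ellipsoids. O_func \<phi> K E = 1} m)
       \<and> {E \<in> ellipsoids. O_func \<phi> K E = 1} = {E \<in> ellipsoids. V_bar \<phi> K E = 1}
       \<and> (\<exists>m. attains_min vol {E \<in> ellipsoids. V_bar \<phi> K E = 1} m \<and>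
              attains_min vol {E \<in> ellipsoids. V_bar \<phi> K E \<le> 1} m)
       \<and> maximizers volume_ratio {E \<in> ellipsoids. O_func \<phi> K E \<le> 1}
           = maximizers volume_ratio {E \<in> ellipsoids. V_bar \<phi> K E \<le> 1}
       \<and> maximizers volume_ratio {E \<in> ellipsoids. V_bar \<phi> K E \<le> 1}
           = minimizers vol {E \<in> ellipsoids. V_bar \<phi> K E \<le> 1}"
proof -
  \<comment> \<open>Once the feasible sets coincide, the statements about \<open>O_func\<close>
    become those about \<open>V_bar\<close>.\<close>
  have "{E \<in> ellipsoids. O_func \<phi> K E = 1} = {E \<in> ellipsoids. V_bar \<phi> K E = 1}"
    and "{E \<in> ellipsoids. O_func \<phi> K E \<le> 1} = {E \<in> ellipsoids. V_bar \<phi> K E \<le> 1}"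
    using O_func_iff_V_bar[OF assms] by auto
  moreover have "maximizers volume_ratio {E \<in> ellipsoids. V_bar \<phi> K E \<le> 1}
      = minimizers vol {E \<in> ellipsoids. V_bar \<phi> K E \<le> 1}"
    by (rule maximizers_eq_minimizers) blast
  ultimately show ?thesis
    using min_volume_attained[OF assms] by auto
qed

end
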